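(* Let $\mathbf{k}$ be a commutative ring with unit. The coproduct $\Delta_{\rm LR}^{\epsilon}$ on $H_{\rm LR}^{\epsilon}$ is uniquely determined by the following three conditions; that is, it satisfies them, and it is the only linear map $\Delta:H_{\rm LR}^{\epsilon}\to H_{\rm LR}^{\epsilon}\otimes H_{\rm LR}^{\epsilon}$ satisfying them: $$\Delta(|)=0,$$ $$\Delta(B^{r}(T))=T\otimes|+(\mathrm{id}\otimes B^{r})\Delta(T),\quad\forall\,T\in H_{\rm LR}^{\epsilon},$$ $$\Delta(S\backslash T)=S\backslash\Delta(T)+\Delta(S)\backslash T,\quad\forall\,S\in H_{\rm LR}^{\epsilon},\ T\in\{|\}\sqcup{\rm P}(\mathcal{Y}),$$ where ${\rm P}(\mathcal{Y})$ is the set of progressive planar binary trees.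
   Context: All modules, tensor products and linear maps are over $\mathbf{k}$. Planar binary trees: a planar binary tree is a finite rooted planar tree in which every internal vertex has exactly two ordered incoming branches (left and right). The trivial tree, with no internal vertices, is denoted $|$. Let $\mathcal{Y}$ be the set of planar binary trees and $H_{\rm LR}^{\epsilon}:=\mathbf{k}\mathcal{Y}$ the free $\mathbf{k}$-module on it. Grafting: for $T_l,T_r\in\mathcal{Y}$, $T_l\vee T_r$ is the tree obtained by creating a new root with left branch $T_l$ and right branch $T_r$; $\vee$ is extended bilinearly. Every $T\in\mathcal{Y}$ with $T\neq |$ is uniquely of the form $T=T_l\vee T_r$. The operator $B^{r}:H_{\rm LR}^{\epsilon}\to H_{\rm LR}^{\epsilon}$ is the linear map with $B^{r}(T)=T\vee|$ for $T\in\mathcal{Y}$. Under product: the bilinear map $\backslash$ on $H_{\rm LR}^{\epsilon}$ where, for trees $S,T$, $S\backslash T$ is obtained by adjoining the root of $T$ to the rightmost branch of $S$; recursively, $|\backslash T=T$ and $(S_l\vee S_r)\backslash T=S_l\vee(S_r\backslash T)$. It is associative with unit $|$. Actions on $H_{\rm LR}^{\epsilon}\otimes H_{\rm LR}^{\epsilon}$: $U\backslash(V\otimes W):=(U\backslash V)\otimes W$ and $(U\otimes V)\backslash W:=U\otimes(V\backslash W)$, extended linearly. Progressive trees: a non-trivial tree $T$ is progressive if its only decompositions $T=R\backslash S$ with $R,S\in\mathcal{Y}$ are $T\backslash|$ and $|\backslash T$; equivalently, $T=T_l\vee|$ for some $T_l\in\mathcal{Y}$. It is known that every non-trivial planar binary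 tree factors uniquely as $U_1\backslash\cdots\backslash U_m$ with $m\ge1$ and each $U_i$ progressive. Infinitesimal coproduct: the linear map $\Delta_{\rm LR}^{\epsilon}:H_{\rm LR}^{\epsilon}\to H_{\rm LR}^{\epsilon}\otimes H_{\rm LR}^{\epsilon}$ defined on trees recursively by $\Delta_{\rm LR}^{\epsilon}(|)=0$ and $$\Delta_{\rm LR}^{\epsilon}(T_l\vee T_r)=T_l\otimes T_r+(\mathrm{id}\otimes\vee)(\Delta_{\rm LR}^{\epsilon}(T_l)\otimes T_r)+(\vee\otimes\mathrm{id})(T_l\otimes\Delta_{\rm LR}^{\epsilon}(T_r)).$$ *)

theory Defs
  imports Complex_Main "HOL-Library.Poly_Mapping"
begin

section \<open>Free modules\<close>

text \<open>
  The free \<open>k\<close>-module on \<open>'a\<close> is the type \<open>'a \<Rightarrow>\<^sub>0 'k\<close> of finitely supported functions.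
  The sort \<open>{comm_ring, comm_monoid_mult}\<close> is that of commutative rings with unit; it is
  \<open>comm_ring_1\<close> without the axiom \<open>0 \<noteq> 1\<close>, so that the zero ring is not excluded.
\<close>

definition smult :: "'k::{comm_ring,comm_monoid_mult} \<Rightarrow> ('a \<Rightarrow>\<^sub>0 'k) \<Rightarrow> ('a \<Rightarrow>\<^sub>0 'k)" where
  "smult c x = Poly_Mapping.map ((*) c) x"

definition basis :: "'a \<Rightarrow> ('a \<Rightarrow>\<^sub>0 'k::{comm_ring,comm_monoid_mult})" where
  "basis a = Poly_Mapping.single a 1"

definition klinear ::
  "(('a \<Rightarrow>\<^sub>0 'k::{comm_ring,comm_monoid_mult}) \<Rightarrow> ('b \<Rightarrow>\<^sub>0 'k)) \<Rightarrow> bool" where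
  "klinear f \<longleftrightarrow> (\<forall>x y. f (x + y) = f x + f y) \<and> (\<forall>c x. f (smult c x) = smult c (f x))"

definition lin_ext ::
  "('a \<Rightarrow> ('b \<Rightarrow>\<^sub>0 'k)) \<Rightarrow> ('a \<Rightarrow>\<^sub>0 'k::{comm_ring,comm_monoid_mult}) \<Rightarrow> ('b \<Rightarrow>\<^sub>0 'k)" where
  "lin_ext f x = (\<Sum>a\<in>Poly_Mapping.keys x. smult (Poly_Mapping.lookup x a) (f a))"

definition bilin_ext ::
  "('a \<Rightarrow> 'b \<Rightarrow> ('c \<Rightarrow>\<^sub>0 'k)) \<Rightarrow> ('a \<Rightarrow>\<^sub>0 'k::{comm_ring,comm_monoid_mult}) \<Rightarrow> ('b \<Rightarrow>\<^sub>0 'k) \<Rightarrow> ('c \<Rightarrow>\<^sub>0 'k)"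
  where "bilin_ext f x y = lin_ext (\<lambda>a. lin_ext (f a) y) x"

lemma lookup_smult [simp]: "Poly_Mapping.lookup (smult c x) a = c * Poly_Mapping.lookup x a"
  by (simp add: smult_def Poly_Mapping.map.rep_eq when_def)

lemma smult_add_right: "smult c (x + y) = smult c x + smult c y"
  by (rule poly_mapping_eqI) (simp add: lookup_add distrib_left)

lemma smult_add_left: "smult (c + d) x = smult c x + smult d x"
  by (rule poly_mapping_eqI) (simp add: lookup_add distrib_right)

lemma smult_smult: "smult c (smult d x) = smult (c * d) x"
  by (rule poly_mapping_eqI) (simp add: mult.assoc)

lemma smult_one [simp]: "smult 1 x = x"
  by (rule poly_mapping_eqI) simp

lemma smult_zero_left [simp]: "smult 0 x = 0"
  by (rule poly_mapping_eqI) simp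

lemma smult_zero_right [simp]: "smult c 0 = 0"
  by (rule poly_mapping_eqI) simp

lemma smult_sum: "smult c (sum f A) = (\<Sum>a\<in>A. smult c (f a))"
  by (induction A rule: infinite_finite_induct) (simp_all add: smult_add_right)

lemma module_smult: "module (smult :: 'k::comm_ring_1 \<Rightarrow> ('a \<Rightarrow>\<^sub>0 'k) \<Rightarrow> ('a \<Rightarrow>\<^sub>0 'k))"
  by unfold_locales (simp_all add: smult_add_right smult_add_left smult_smult)

lemma klinear_iff_module_hom:
  fixes f :: "('a \<Rightarrow>\<^sub>0 'k::comm_ring_1) \<Rightarrow> ('b \<Rightarrow>\<^sub>0 'k)"
  shows "klinear f \<longleftrightarrow> module_hom smult smult f"
  by (auto simp: klinear_def module_hom_iff module_smult)

lemma lin_ext_superset: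
  assumes "finite A" "Poly_Mapping.keys x \<subseteq> A"
  shows "lin_ext f x = (\<Sum>a\<in>A. smult (Poly_Mapping.lookup x a) (f a))"
  unfolding lin_ext_def using assms
  by (intro sum.mono_neutral_left) (auto simp: in_keys_iff)

lemma klinear_lin_ext: "klinear (lin_ext f)"
proof -
  have "lin_ext f (x + y) = lin_ext f x + lin_ext f y" for x y
    using Poly_Mapping.keys_add[of x y]
    by (simp add: lin_ext_superset[of "Poly_Mapping.keys x \<union> Poly_Mapping.keys y"]
        lookup_add smult_add_left sum.distrib)
  moreover have "lin_ext f (smult c x) = smult c (lin_ext f x)" for c x
  proof -
    have "Poly_Mapping.keys (smult c x) \<subseteq> Poly_Mapping.keys x"
      by (auto simp: in_keys_iff)
    then show ?thesis
      by (simp add: lin_ext_superset[of "Poly_Mapping.keys x"] smult_sum smult_smult)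
  qed
  ultimately show ?thesis by (simp add: klinear_def)
qed

lemma lin_ext_basis [simp]: "lin_ext f (basis a) = f a"
proof -
  have "lin_ext f (basis a) = (\<Sum>b\<in>{a}. smult (Poly_Mapping.lookup (basis a) b) (f b))"
    by (rule lin_ext_superset) (auto simp: basis_def in_keys_iff lookup_single when_def)
  then show ?thesis by (simp add: basis_def)
qed

lemma basis_expansion:
  "x = (\<Sum>a\<in>Poly_Mapping.keys x. smult (Poly_Mapping.lookup x a) (basis a))"
proof (rule poly_mapping_eqI)
  fix b
  have "Poly_Mapping.lookup (\<Sum>a\<in>Poly_Mapping.keys x. smult (Poly_Mapping.lookup x a) (basis a)) b
      = (\<Sum>a\<in>Poly_Mapping.keys x. if a = b then Poly_Mapping.lookup x a else 0)"
    unfolding lookup_sum by (intro sum.cong) (auto simp: basis_def lookup_single when_def)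
  then show "Poly_Mapping.lookup x b =
      Poly_Mapping.lookup (\<Sum>a\<in>Poly_Mapping.keys x. smult (Poly_Mapping.lookup x a) (basis a)) b"
    by (simp add: in_keys_iff)
qed


section \<open>Tensor products of free modules\<close>

text \<open>
  The tensor product of the free modules on \<open>'a\<close> and \<open>'b\<close> is realised as the free module on
  \<open>'a \<times> 'b\<close>. The lemma \<open>tensor_universal\<close> below is its universal property, for bilinear maps
  into an arbitrary module \<open>(M, scale)\<close>.
\<close>

definition tensor ::
  "('a \<Rightarrow>\<^sub>0 'k::{comm_ring,comm_monoid_mult}) \<Rightarrow> ('b \<Rightarrow>\<^sub>0 'k) \<Rightarrow> ('a \<times> 'b \<Rightarrow>\<^sub>0 'k)" (infixl "\<otimes>" 70)
  where "x \<otimes> y = bilin_ext (\<lambda>a b. basis (a, b)) x y"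

definition tensor_map ::
  "(('a \<Rightarrow>\<^sub>0 'k::{comm_ring,comm_monoid_mult}) \<Rightarrow> ('c \<Rightarrow>\<^sub>0 'k)) \<Rightarrow>
   (('b \<Rightarrow>\<^sub>0 'k) \<Rightarrow> ('d \<Rightarrow>\<^sub>0 'k)) \<Rightarrow> ('a \<times> 'b \<Rightarrow>\<^sub>0 'k) \<Rightarrow> ('c \<times> 'd \<Rightarrow>\<^sub>0 'k)" where
  "tensor_map f g = lin_ext (\<lambda>(a, b). f (basis a) \<otimes> g (basis b))"

definition assoc ::
  "(('a \<times> 'b) \<times> 'c \<Rightarrow>\<^sub>0 'k::{comm_ring,comm_monoid_mult}) \<Rightarrow> ('a \<times> ('b \<times> 'c) \<Rightarrow>\<^sub>0 'k)" where
  "assoc = lin_ext (\<lambda>((a, b), c). basis (a, (b, c)))"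

definition assoc_inv ::
  "('a \<times> ('b \<times> 'c) \<Rightarrow>\<^sub>0 'k::{comm_ring,comm_monoid_mult}) \<Rightarrow> (('a \<times> 'b) \<times> 'c \<Rightarrow>\<^sub>0 'k)" where
  "assoc_inv = lin_ext (\<lambda>(a, (b, c)). basis ((a, b), c))"

lemma lookup_tensor:
  "Poly_Mapping.lookup (x \<otimes> y) (a, b) = Poly_Mapping.lookup x a * Poly_Mapping.lookup y b"
proof -
  have "Poly_Mapping.lookup (x \<otimes> y) (a, b) =
      (\<Sum>a'\<in>Poly_Mapping.keys x. \<Sum>b'\<in>Poly_Mapping.keys y.
        if b' = b then (if a' = a then Poly_Mapping.lookup x a' * Poly_Mapping.lookup y b' else 0) else 0)"
    unfolding tensor_def bilin_ext_def lin_ext_def lookup_sum lookup_smult sum_distrib_left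
    by (intro sum.cong refl) (auto simp: basis_def lookup_single when_def)
  also have "\<dots> = (\<Sum>a'\<in>Poly_Mapping.keys x.
      if a' = a then Poly_Mapping.lookup x a' * Poly_Mapping.lookup y b else 0)"
    by (intro sum.cong refl) (auto simp: in_keys_iff)
  also have "\<dots> = Poly_Mapping.lookup x a * Poly_Mapping.lookup y b"
    by (auto simp: in_keys_iff)
  finally show ?thesis .
qed

lemma tensor_basis: "basis a \<otimes> basis b = basis (a, b)"
  by (simp add: tensor_def bilin_ext_def)

lemma tensor_bilinear: "klinear (\<lambda>x. x \<otimes> y)" "klinear (\<lambda>y. x \<otimes> y)"
  unfolding klinear_def
  by (auto intro!: poly_mapping_eqI simp: lookup_tensor lookup_add algebra_simps)

lemma tensor_universal:
  fixes scale :: "'k::{comm_ring,comm_monoid_mult} \<Rightarrow> 'm::ab_group_add \<Rightarrow> 'm"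
    and \<beta> :: "('a \<Rightarrow>\<^sub>0 'k) \<Rightarrow> ('b \<Rightarrow>\<^sub>0 'k) \<Rightarrow> 'm"
  assumes scale: "\<And>c u v. scale c (u + v) = scale c u + scale c v"
      "\<And>c d u. scale (c + d) u = scale c u + scale d u"
      "\<And>c d u. scale c (scale d u) = scale (c * d) u"
      "\<And>u. scale 1 u = u"
    and bilinear: "\<And>x x' y. \<beta> (x + x') y = \<beta> x y + \<beta> x' y"
      "\<And>x y y'. \<beta> x (y + y') = \<beta> x y + \<beta> x y'"
      "\<And>c x y. \<beta> (smult c x) y = scale c (\<beta> x y)"
      "\<And>c x y. \<beta> x (smult c y) = scale c (\<beta> x y)"
  shows "\<exists>!\<phi> :: ('a \<times> 'b \<Rightarrow>\<^sub>0 'k) \<Rightarrow> 'm.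
    (\<forall>z w. \<phi> (z + w) = \<phi> z + \<phi> w) \<and> (\<forall>c z. \<phi> (smult c z) = scale c (\<phi> z)) \<and>
    (\<forall>x y. \<phi> (x \<otimes> y) = \<beta> x y)"
proof -
  define \<phi> :: "('a \<times> 'b \<Rightarrow>\<^sub>0 'k) \<Rightarrow> 'm" where
    "\<phi> z = (\<Sum>p\<in>Poly_Mapping.keys z.
      scale (Poly_Mapping.lookup z p) (\<beta> (basis (fst p)) (basis (snd p))))" for z
  have s0 [simp]: "scale 0 u = 0" for u
    using scale(2)[of 0 0 u] by simp
  have s0' [simp]: "scale c 0 = 0" for c
    using scale(1)[of c 0 0] by simp
  have s_sum: "scale c (sum f A) = (\<Sum>a\<in>A. scale c (f a))" for c f and A :: "'x set"
    by (induction A rule: infinite_finite_induct) (simp_all add: scale)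
  have \<phi>_sup: "\<phi> z = (\<Sum>p\<in>A. scale (Poly_Mapping.lookup z p) (\<beta> (basis (fst p)) (basis (snd p))))"
    if "finite A" "Poly_Mapping.keys z \<subseteq> A" for z A
    unfolding \<phi>_def using that by (intro sum.mono_neutral_left) (auto simp: in_keys_iff)
  have \<phi>_add: "\<phi> (z + w) = \<phi> z + \<phi> w" for z w
    using Poly_Mapping.keys_add[of z w]
    by (simp add: \<phi>_sup[of "Poly_Mapping.keys z \<union> Poly_Mapping.keys w"] lookup_add scale sum.distrib)
  have \<phi>_smult: "\<phi> (smult c z) = scale c (\<phi> z)" for c z
  proof -
    have "Poly_Mapping.keys (smult c z) \<subseteq> Poly_Mapping.keys z"
      by (auto simp: in_keys_iff)
    then show ?thesis
      by (simp add: \<phi>_sup[of "Poly_Mapping.keys z"] s_sum scale)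
  qed
  have ext: "f = g"
    if "\<And>x y. f (x + y) = f x + f y" "\<And>c x. f (smult c x) = scale c (f x)"
      "\<And>x y. g (x + y) = g x + g y" "\<And>c x. g (smult c x) = scale c (g x)"
      "\<And>a. f (basis a) = g (basis a)" for f g :: "('c \<Rightarrow>\<^sub>0 'k) \<Rightarrow> 'm"
  proof
    fix x
    have z: "f 0 = 0" "g 0 = 0"
      using that(1)[of 0 0] that(3)[of 0 0] by simp_all
    have "f (\<Sum>a\<in>A. smult (h a) (basis a)) = g (\<Sum>a\<in>A. smult (h a) (basis a))" for A and h :: "'c \<Rightarrow> 'k"
      by (induction A rule: infinite_finite_induct) (simp_all add: that z)
    then show "f x = g x"
      by (subst (1 2) basis_expansion)
  qed
  have \<phi>_basis: "\<phi> (basis (a, b)) = \<beta> (basis a) (basis b)" for a b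
  proof -
    have "\<phi> (basis (a, b)) = (\<Sum>p\<in>{(a, b)}.
        scale (Poly_Mapping.lookup (basis (a, b)) p) (\<beta> (basis (fst p)) (basis (snd p))))"
      by (rule \<phi>_sup) (auto simp: basis_def in_keys_iff lookup_single when_def)
    then show ?thesis by (simp add: basis_def scale)
  qed
  note tl = tensor_bilinear[unfolded klinear_def]
  have 1: "(\<lambda>y. \<phi> (basis a \<otimes> y)) = \<beta> (basis a)" for a
    by (rule ext) (simp_all add: tl \<phi>_add \<phi>_smult bilinear tensor_basis \<phi>_basis)
  have 2: "(\<lambda>x. \<phi> (x \<otimes> y)) = (\<lambda>x. \<beta> x y)" for y
    by (rule ext) (simp_all add: tl \<phi>_add \<phi>_smult bilinear fun_cong[OF 1])
  show ?thesis
  proof (rule ex1I[of _ \<phi>])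
    show "(\<forall>z w. \<phi> (z + w) = \<phi> z + \<phi> w) \<and> (\<forall>c z. \<phi> (smult c z) = scale c (\<phi> z)) \<and>
        (\<forall>x y. \<phi> (x \<otimes> y) = \<beta> x y)"
      using \<phi>_add \<phi>_smult fun_cong[OF 2] by blast
  next
    fix \<psi> :: "('a \<times> 'b \<Rightarrow>\<^sub>0 'k) \<Rightarrow> 'm"
    assume \<psi>: "(\<forall>z w. \<psi> (z + w) = \<psi> z + \<psi> w) \<and> (\<forall>c z. \<psi> (smult c z) = scale c (\<psi> z)) \<and>
        (\<forall>x y. \<psi> (x \<otimes> y) = \<beta> x y)"
    then have "\<psi> (basis p) = \<phi> (basis p)" for p
      by (cases p) (metis tensor_basis \<phi>_basis)
    then show "\<psi> = \<phi>"
      using \<psi> \<phi>_add \<phi>_smult by (intro ext) auto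
  qed
qed


section \<open>Planar binary trees\<close>

datatype pbtree = Triv | Graft pbtree pbtree

primrec tree_under :: "pbtree \<Rightarrow> pbtree \<Rightarrow> pbtree" where
  "tree_under Triv T = T"
| "tree_under (Graft Sl Sr) T = Graft Sl (tree_under Sr T)"

definition progressive :: "pbtree \<Rightarrow> bool" where
  "progressive T \<longleftrightarrow> T \<noteq> Triv \<and>
    (\<forall>R S. T = tree_under R S \<longrightarrow> (R = T \<and> S = Triv) \<or> (R = Triv \<and> S = T))"


section \<open>Operations and the infinitesimal coproduct on the free module on trees\<close>

definition Br :: "(pbtree \<Rightarrow>\<^sub>0 'k::{comm_ring,comm_monoid_mult}) \<Rightarrow> (pbtree \<Rightarrow>\<^sub>0 'k)" where
  "Br = lin_ext (\<lambda>T. basis (Graft T Triv))"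

text \<open>The bilinear extension of grafting, as a linear map on the tensor square.\<close>

definition graft :: "(pbtree \<times> pbtree \<Rightarrow>\<^sub>0 'k::{comm_ring,comm_monoid_mult}) \<Rightarrow> (pbtree \<Rightarrow>\<^sub>0 'k)" where
  "graft = lin_ext (\<lambda>(Tl, Tr). basis (Graft Tl Tr))"

definition under_prod ::
  "(pbtree \<Rightarrow>\<^sub>0 'k::{comm_ring,comm_monoid_mult}) \<Rightarrow> (pbtree \<Rightarrow>\<^sub>0 'k) \<Rightarrow> (pbtree \<Rightarrow>\<^sub>0 'k)" where
  "under_prod = bilin_ext (\<lambda>S T. basis (tree_under S T))"

definition left_under ::
  "(pbtree \<Rightarrow>\<^sub>0 'k::{comm_ring,comm_monoid_mult}) \<Rightarrow> (pbtree \<times> pbtree \<Rightarrow>\<^sub>0 'k) \<Rightarrow> (pbtree \<times> pbtree \<Rightarrow>\<^sub>0 'k)"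
  where "left_under = bilin_ext (\<lambda>U (V, W). under_prod (basis U) (basis V) \<otimes> basis W)"

definition right_under ::
  "(pbtree \<times> pbtree \<Rightarrow>\<^sub>0 'k::{comm_ring,comm_monoid_mult}) \<Rightarrow> (pbtree \<Rightarrow>\<^sub>0 'k) \<Rightarrow> (pbtree \<times> pbtree \<Rightarrow>\<^sub>0 'k)"
  where "right_under = bilin_ext (\<lambda>(U, V) W. basis U \<otimes> under_prod (basis V) (basis W))"

primrec tree_coproduct :: "pbtree \<Rightarrow> (pbtree \<times> pbtree \<Rightarrow>\<^sub>0 'k::{comm_ring,comm_monoid_mult})" where
  "tree_coproduct Triv = 0"
| "tree_coproduct (Graft Tl Tr) =
     basis Tl \<otimes> basis Tr
     + tensor_map id graft (assoc (tree_coproduct Tl \<otimes> basis Tr))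
     + tensor_map graft id (assoc_inv (basis Tl \<otimes> tree_coproduct Tr))"

definition coproduct_LR ::
  "(pbtree \<Rightarrow>\<^sub>0 'k::{comm_ring,comm_monoid_mult}) \<Rightarrow> (pbtree \<times> pbtree \<Rightarrow>\<^sub>0 'k)" where
  "coproduct_LR = lin_ext tree_coproduct"

end

theory Submission
  imports Defs
begin

text \<open>
  Everything is linear, so both directions reduce to trees.

  That the coproduct satisfies the conditions: in the recursion for a grafting \<open>l \<or> r\<close>, the two
  summands containing a coproduct apply to it the maps \<open>V \<otimes> W \<mapsto> V \<otimes> (W \<or> r)\<close> and
  \<open>V \<otimes> W \<mapsto> (l \<or> V) \<otimes> W\<close>. For \<open>r = |\<close> the second of
  these vanishes and the recursion is the \<open>B\<^sup>r\<close> equation. Since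
  \<open>(l \<or> r) \<setminus> T = l \<or> (r \<setminus> T)\<close>, the under product touches only the right branch of its left
  factor and so is compatible with these maps; induction on that factor yields the Leibniz rule
  (\<open>tree_coproduct_under\<close>).

  Uniqueness: a tree is assembled from \<open>|\<close> by the operation \<open>B\<^sup>r\<close> and by multiplication on the
  right by progressive trees \<open>l \<or> |\<close>, because
  \<open>l \<or> r = (l \<or> |) \<setminus> r\<close> and the under product is associative. The conditions determine the
  value at each step of this construction, which is an induction principle for trees
  (\<open>pbtree_progressive_induct\<close>).
\<close>

section \<open>Linear maps on free modules\<close>

lemma klinearD:
  assumes "klinear f"
  shows "f (x + y) = f x + f y" "f (smult c x) = smult c (f x)" "f 0 = 0"
proof -
  show add: "f (x + y) = f x + f y" for x y
    using assms by (simp add: klinear_def)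
  show "f (smult c x) = smult c (f x)"
    using assms by (simp add: klinear_def)
  show "f 0 = 0"
    using add[of 0 0] by simp
qed

lemma klinear_eqI:
  assumes "klinear f" "klinear g" "\<And>a. f (basis a) = g (basis a)"
  shows "f x = g x"
proof -
  have "f (\<Sum>a\<in>A. smult (h a) (basis a)) = g (\<Sum>a\<in>A. smult (h a) (basis a))" for A h
    by (induction A rule: infinite_finite_induct)
      (simp_all add: klinearD[OF assms(1)] klinearD[OF assms(2)] assms(3))
  then show ?thesis
    by (subst (1 2) basis_expansion)
qed

lemma klinear_comp:
  assumes "klinear f" "klinear g"
  shows "klinear (\<lambda>x. f (g x))"
  using assms by (simp add: klinear_def)

lemma klinear_add:
  assumes "klinear f" "klinear g"
  shows "klinear (\<lambda>x. f x + g x)"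
  using assms by (simp add: klinear_def smult_add_right add_ac)

lemma klinear_bilin_ext_left: "klinear (\<lambda>x. bilin_ext f x y)"
  unfolding bilin_ext_def by (rule klinear_lin_ext)

lemma klinear_bilin_ext_right: "klinear (\<lambda>y. bilin_ext f x y)"
  unfolding klinear_def bilin_ext_def
proof (intro conjI allI)
  show "lin_ext (\<lambda>a. lin_ext (f a) (y + z)) x
      = lin_ext (\<lambda>a. lin_ext (f a) y) x + lin_ext (\<lambda>a. lin_ext (f a) z) x" for y z
    by (simp add: lin_ext_def[of _ x] klinearD(1)[OF klinear_lin_ext] smult_add_right sum.distrib)
  show "lin_ext (\<lambda>a. lin_ext (f a) (smult c y)) x
      = smult c (lin_ext (\<lambda>a. lin_ext (f a) y) x)" for c y
    by (simp add: lin_ext_def[of _ x] klinearD(2)[OF klinear_lin_ext] smult_sum smult_smult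
        mult.commute)
qed

lemma klinear_tree_operations:
  shows klinear_Br: "klinear Br"
    and klinear_tensor_map: "klinear (tensor_map f g)"
    and klinear_coproduct_LR: "klinear coproduct_LR"
    and klinear_assoc: "klinear assoc"
    and klinear_assoc_inv: "klinear assoc_inv"
    and klinear_under_prod_left: "klinear (\<lambda>S. under_prod S T)"
    and klinear_left_under_left: "klinear (\<lambda>S. left_under S y)"
    and klinear_left_under_right: "klinear (left_under S)"
    and klinear_right_under_left: "klinear (\<lambda>x. right_under x T)"
  unfolding Br_def tensor_map_def coproduct_LR_def assoc_def assoc_inv_def under_prod_def
    left_under_def right_under_def
  by (rule klinear_lin_ext klinear_bilin_ext_left klinear_bilin_ext_right)+

lemma under_prod_basis: "under_prod (basis S) (basis T) = basis (tree_under S T)"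
  by (simp add: under_prod_def bilin_ext_def)

lemma left_under_basis: "left_under (basis U) (basis (V, W)) = basis (tree_under U V, W)"
  by (simp add: left_under_def bilin_ext_def under_prod_basis tensor_basis)

lemma right_under_basis: "right_under (basis (U, V)) (basis W) = basis (U, tree_under V W)"
  by (simp add: right_under_def bilin_ext_def under_prod_basis tensor_basis)

lemma Br_basis: "Br (basis T) = basis (Graft T Triv)"
  by (simp add: Br_def)


section \<open>The coproduct satisfies the three conditions\<close>

definition graft_snd ::
  "pbtree \<Rightarrow> (pbtree \<times> pbtree \<Rightarrow>\<^sub>0 'k::{comm_ring,comm_monoid_mult}) \<Rightarrow> (pbtree \<times> pbtree \<Rightarrow>\<^sub>0 'k)" where
  "graft_snd r = lin_ext (\<lambda>(V, W). basis (V, Graft W r))"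

definition graft_fst ::
  "pbtree \<Rightarrow> (pbtree \<times> pbtree \<Rightarrow>\<^sub>0 'k::{comm_ring,comm_monoid_mult}) \<Rightarrow> (pbtree \<times> pbtree \<Rightarrow>\<^sub>0 'k)" where
  "graft_fst l = lin_ext (\<lambda>(V, W). basis (Graft l V, W))"

lemma klinear_graft_snd: "klinear (graft_snd r)"
  unfolding graft_snd_def by (rule klinear_lin_ext)

lemma klinear_graft_fst: "klinear (graft_fst l)"
  unfolding graft_fst_def by (rule klinear_lin_ext)

lemma graft_snd_basis [simp]: "graft_snd r (basis (V, W)) = basis (V, Graft W r)"
  by (simp add: graft_snd_def)

lemma graft_fst_basis [simp]: "graft_fst l (basis (V, W)) = basis (Graft l V, W)"
  by (simp add: graft_fst_def)

lemma tensor_map_id_graft: "tensor_map id graft (assoc (x \<otimes> basis r)) = graft_snd r x"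
proof (rule klinear_eqI[of "\<lambda>x. tensor_map id graft (assoc (x \<otimes> basis r))"])
  show "klinear (\<lambda>x. tensor_map id graft (assoc (x \<otimes> basis r)))"
    by (intro klinear_comp[OF klinear_tensor_map] klinear_comp[OF klinear_assoc] tensor_bilinear)
  show "tensor_map id graft (assoc (basis p \<otimes> basis r)) = graft_snd r (basis p)" for p
    by (cases p) (simp add: tensor_basis assoc_def tensor_map_def graft_def)
qed (rule klinear_graft_snd)

lemma tensor_map_graft_id: "tensor_map graft id (assoc_inv (basis l \<otimes> x)) = graft_fst l x"
proof (rule klinear_eqI[of "\<lambda>x. tensor_map graft id (assoc_inv (basis l \<otimes> x))"])
  show "klinear (\<lambda>x. tensor_map graft id (assoc_inv (basis l \<otimes> x)))"
    by (intro klinear_comp[OF klinear_tensor_map] klinear_comp[OF klinear_assoc_inv] tensor_bilinear)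
  show "tensor_map graft id (assoc_inv (basis l \<otimes> basis p)) = graft_fst l (basis p)" for p
    by (cases p) (simp add: tensor_basis assoc_inv_def tensor_map_def graft_def)
qed (rule klinear_graft_fst)

lemma tree_coproduct_Graft:
  "tree_coproduct (Graft l r)
    = basis (l, r) + graft_snd r (tree_coproduct l) + graft_fst l (tree_coproduct r)"
  by (simp add: tensor_map_id_graft tensor_map_graft_id tensor_basis)

text \<open>
  How the two maps interact with the actions of the under product. When both operate on the same
  tensor factor this is \<open>(l \<or> r) \<setminus> T = l \<or> (r \<setminus> T)\<close>; on different factors they commute.
\<close>

lemma graft_fst_left_under:
  "graft_fst l (left_under (basis r) x) = left_under (basis (Graft l r)) x"
proof (rule klinear_eqI[of "\<lambda>x. graft_fst l (left_under (basis r) x)"])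
  show "graft_fst l (left_under (basis r) (basis p)) = left_under (basis (Graft l r)) (basis p)" for p
    by (cases p) (simp add: left_under_basis)
qed (intro klinear_comp[OF klinear_graft_fst] klinear_left_under_right)+

lemma graft_fst_right_under:
  "graft_fst l (right_under x (basis T)) = right_under (graft_fst l x) (basis T)"
proof (rule klinear_eqI[of "\<lambda>x. graft_fst l (right_under x (basis T))"])
  show "graft_fst l (right_under (basis p) (basis T))
      = right_under (graft_fst l (basis p)) (basis T)" for p
    by (cases p) (simp add: right_under_basis)
  show "klinear (\<lambda>x. graft_fst l (right_under x (basis T)))"
    by (intro klinear_comp[OF klinear_graft_fst] klinear_right_under_left)
  show "klinear (\<lambda>x. right_under (graft_fst l x) (basis T))"
    by (intro klinear_comp[OF klinear_right_under_left] klinear_graft_fst)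
qed

lemma graft_snd_tree_under:
  "graft_snd (tree_under r T) x = right_under (graft_snd r x) (basis T)"
proof (rule klinear_eqI[of "graft_snd (tree_under r T)"])
  show "graft_snd (tree_under r T) (basis p) = right_under (graft_snd r (basis p)) (basis T)" for p
    by (cases p) (simp add: right_under_basis)
  show "klinear (\<lambda>x. right_under (graft_snd r x) (basis T))"
    by (intro klinear_comp[OF klinear_right_under_left] klinear_graft_snd)
qed (rule klinear_graft_snd)

text \<open>
  The Leibniz rule on trees. In the induction step, the term
  \<open>S \<setminus> \<Delta>(T)\<close> and the part of \<open>\<Delta>(S) \<setminus> T\<close> that cuts inside the right branch of \<open>S\<close> come from the
  induction hypothesis; the other two summands of the recursion for \<open>S \<setminus> T\<close> supply the rest of \<open>\<Delta>(S) \<setminus> T\<close>.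
\<close>

lemma tree_coproduct_under:
  "tree_coproduct (tree_under S T)
    = left_under (basis S) (tree_coproduct T) + right_under (tree_coproduct S) (basis T)"
proof (induction S)
  case Triv
  have "left_under (basis Triv) x = x" for x :: "pbtree \<times> pbtree \<Rightarrow>\<^sub>0 'a"
  proof (rule klinear_eqI[of "left_under (basis Triv)" "\<lambda>x. x"])
    show "left_under (basis Triv) (basis p) = basis p" for p
      by (cases p) (simp add: left_under_basis)
    show "klinear (\<lambda>x :: pbtree \<times> pbtree \<Rightarrow>\<^sub>0 'a. x)"
      by (simp add: klinear_def)
  qed (rule klinear_left_under_right)
  then show ?case
    by (simp add: klinearD(3)[OF klinear_right_under_left])
next
  case (Graft l r)
  show ?case
    unfolding tree_under.simps tree_coproduct_Graft Graft.IH(2)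
    by (simp only: klinearD(1)[OF klinear_graft_fst] klinearD(1)[OF klinear_right_under_left]
        graft_fst_left_under graft_fst_right_under graft_snd_tree_under right_under_basis add_ac)
qed

lemma coproduct_LR_basis: "coproduct_LR (basis T) = tree_coproduct T"
  by (simp add: coproduct_LR_def)

lemma coproduct_LR_Triv: "coproduct_LR (basis Triv) = 0"
  by (simp add: coproduct_LR_basis)

lemma coproduct_LR_under_prod:
  "coproduct_LR (under_prod S (basis T))
    = left_under S (coproduct_LR (basis T)) + right_under (coproduct_LR S) (basis T)"
proof (rule klinear_eqI[of "\<lambda>S. coproduct_LR (under_prod S (basis T))"])
  show "klinear (\<lambda>S. coproduct_LR (under_prod S (basis T)))"
    by (intro klinear_comp[OF klinear_coproduct_LR] klinear_under_prod_left)
  show "klinear (\<lambda>S. left_under S (coproduct_LR (basis T)) + right_under (coproduct_LR S) (basis T))"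
    by (intro klinear_add klinear_comp[OF klinear_right_under_left]
        klinear_left_under_left klinear_coproduct_LR)
qed (simp add: under_prod_basis coproduct_LR_basis tree_coproduct_under)

lemma tensor_map_id_Br: "tensor_map id Br = graft_snd Triv"
  by (simp add: tensor_map_def graft_snd_def tensor_basis Br_basis)

lemma coproduct_LR_Br:
  "coproduct_LR (Br T) = T \<otimes> basis Triv + tensor_map id Br (coproduct_LR T)"
proof (rule klinear_eqI[of "\<lambda>T. coproduct_LR (Br T)"])
  show "klinear (\<lambda>T. coproduct_LR (Br T))"
    by (intro klinear_comp[OF klinear_coproduct_LR] klinear_Br)
  show "klinear (\<lambda>T. T \<otimes> basis Triv + tensor_map id Br (coproduct_LR T))"
    by (intro klinear_add tensor_bilinear klinear_comp[OF klinear_tensor_map] klinear_coproduct_LR)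
  show "coproduct_LR (Br (basis l))
      = basis l \<otimes> basis Triv + tensor_map id Br (coproduct_LR (basis l))" for l
    by (simp add: Br_basis coproduct_LR_basis tree_coproduct_Graft tensor_basis tensor_map_id_Br
        klinearD(3)[OF klinear_graft_fst] del: tree_coproduct.simps(2))
qed


section \<open>Uniqueness\<close>

lemma tree_under_Triv_right [simp]: "tree_under S Triv = S"
  by (induction S) simp_all

lemma tree_under_assoc: "tree_under (tree_under R S) T = tree_under R (tree_under S T)"
  by (induction R) simp_all

lemma progressive_Graft_Triv: "progressive (Graft l Triv)"
proof -
  have no_split: "R = Triv \<and> S = Triv" if "tree_under R S = Triv" for R S
    using that by (cases R) simp_all
  have "(R = Graft l Triv \<and> S = Triv) \<or> (R = Triv \<and> S = Graft l Triv)"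
    if "Graft l Triv = tree_under R S" for R S
    using that by (cases R) (auto dest: no_split[OF sym])
  then show ?thesis
    by (simp add: progressive_def)
qed

text \<open>
  The induction principle behind uniqueness. Quantifying over a left factor \<open>S\<close> that already has
  the property makes structural induction on the right factor go through:
  \<open>S \<setminus> (l \<or> r) = (S \<setminus> (l \<or> |)) \<setminus> r\<close>, where the left branch \<open>l\<close> yields the property
  for the progressive tree \<open>l \<or> |\<close> and the right branch \<open>r\<close> is handled with a larger left factor.
\<close>

lemma pbtree_progressive_induct [case_names Triv Graft_Triv under]:
  assumes Triv: "P Triv"
    and Graft_Triv: "\<And>l. P l \<Longrightarrow> P (Graft l Triv)"
    and under: "\<And>S T. P S \<Longrightarrow> P T \<Longrightarrow> progressive T \<Longrightarrow> P (tree_under S T)"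
  shows "P T"
proof -
  have "P S \<Longrightarrow> P (tree_under S T)" for S
  proof (induction T arbitrary: S)
    case Triv
    then show ?case by simp
  next
    case (Graft l r)
    have "P l"
      using Graft.IH(1)[OF Triv] by simp
    then have "P (tree_under S (Graft l Triv))"
      using Graft.prems by (intro under Graft_Triv progressive_Graft_Triv)
    from Graft.IH(2)[OF this] show ?case
      by (simp add: tree_under_assoc)
  qed
  from this[OF Triv] show ?thesis by simp
qed

theorem proposition4p2:
  fixes \<Delta> :: "(pbtree \<Rightarrow>\<^sub>0 'k::{comm_ring,comm_monoid_mult}) \<Rightarrow> (pbtree \<times> pbtree \<Rightarrow>\<^sub>0 'k)"
  shows "klinear \<Delta>
       \<and> \<Delta> (basis Triv) = 0
       \<and> (\<forall>T. \<Delta> (Br T) = T \<otimes> basis Triv + tensor_map id Br (\<Delta> T))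
       \<and> (\<forall>S. \<forall>T \<in> {Triv} \<union> {P. progressive P}.
            \<Delta> (under_prod S (basis T)) = left_under S (\<Delta> (basis T)) + right_under (\<Delta> S) (basis T))
     \<longleftrightarrow> \<Delta> = coproduct_LR"
    (is "?conditions \<longleftrightarrow> _")
proof
  assume "\<Delta> = coproduct_LR"
  then show ?conditions
    by (simp add: klinear_coproduct_LR coproduct_LR_Triv coproduct_LR_Br coproduct_LR_under_prod)
next
  assume conditions: ?conditions
  then have linear: "klinear \<Delta>"
    and Br: "\<Delta> (Br T) = T \<otimes> basis Triv + tensor_map id Br (\<Delta> T)"
    and Leibniz: "progressive P \<Longrightarrow>
      \<Delta> (under_prod S (basis P)) = left_under S (\<Delta> (basis P)) + right_under (\<Delta> S) (basis P)"
    for S T P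
    by auto
  have "\<Delta> (basis T) = coproduct_LR (basis T)" for T
  proof (induction T rule: pbtree_progressive_induct)
    case Triv
    show ?case
      using conditions by (simp add: coproduct_LR_Triv)
  next
    case (Graft_Triv l)
    then show ?case
      using Br[of "basis l"] coproduct_LR_Br[of "basis l :: pbtree \<Rightarrow>\<^sub>0 'k"]
      by (simp add: Br_basis)
  next
    case (under S T)
    then show ?case
      using Leibniz[OF under(3), of "basis S"]
        coproduct_LR_under_prod[of "basis S :: pbtree \<Rightarrow>\<^sub>0 'k" T]
      by (simp add: under_prod_basis)
  qed
  then show "\<Delta> = coproduct_LR"
    using klinear_eqI[OF linear klinear_coproduct_LR] by blast
qed

end
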